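(* Let $d\ge 0$ be an integer and let $G$ be a $d$-degenerate graph. Then $G$ is $\left(d+2, \frac{1}{2^{d+1}}\right)$-flexible.
   Context: All graphs are finite, simple and nonempty. A graph is $d$-degenerate if its vertices can be ordered so that each vertex has at most $d$ neighbors preceding it in the ordering. A list assignment $L$ for $G$ assigns to each vertex $v$ a set $L(v)$ of colors; it is a $k$-assignment if $|L(v)|=k$ for all $v$. A proper $L$-coloring is a function $f$ on $V(G)$ with $f(v)\in L(v)$ for all $v$ and $f(u)\neq f(v)$ whenever $uv\in E(G)$. A request of $L$ is a function $r$ with non-empty domain $D\subseteq V(G)$ such that $r(v)\in L(v)$ for each $v\in D$. For $\epsilon\in(0,1]$, the triple $(G,L,r)$ is $\epsilon$-satisfiable if there is a proper $L$-coloring $f$ of $G$ with $f(v)=r(v)$ for at least $\epsilon|D|$ vertices $v\in D$. $G$ is $(k,\epsilon)$-flexible if $(G,L,r)$ is $\epsilon$-satisfiable for every $k$-assignment $L$ for $G$ and every request $r$ of $L$. *)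

theory Defs
  imports Complex_Main "Graph_Theory.Digraph"
begin

text \<open>
  A finite simple graph is a digraph satisfying the locale predicate \<^locale>\<open>graph\<close>: finite,
  loop-free, without parallel arcs, and symmetric, so each undirected edge is a pair of opposite
  arcs. Adjacency of \<open>u\<close> and \<open>v\<close> is \<open>u \<rightarrow>\<^bsub>G\<^esub> v\<close>.
\<close>

definition degenerate :: "('a, 'b) pre_digraph \<Rightarrow> nat \<Rightarrow> bool" where
  "degenerate G d \<longleftrightarrow>
     (\<exists>vs. distinct vs \<and> set vs = verts G \<and>
        (\<forall>i < length vs. card {u \<in> set (take i vs). u \<rightarrow>\<^bsub>G\<^esub> vs ! i} \<le> d))"

text \<open>
  List assignments and colorings are total HOL functions; only their values on
  \<open>verts G\<close> matter.
\<close>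

text \<open>The finiteness conjunct matters only for \<open>k = 0\<close>, as \<open>card\<close> of an infinite set is 0.\<close>

definition k_assignment :: "('a, 'b) pre_digraph \<Rightarrow> nat \<Rightarrow> ('a \<Rightarrow> 'c set) \<Rightarrow> bool" where
  "k_assignment G k L \<longleftrightarrow> (\<forall>v \<in> verts G. finite (L v) \<and> card (L v) = k)"

definition proper_list_coloring ::
    "('a, 'b) pre_digraph \<Rightarrow> ('a \<Rightarrow> 'c set) \<Rightarrow> ('a \<Rightarrow> 'c) \<Rightarrow> bool" where
  "proper_list_coloring G L f \<longleftrightarrow>
     (\<forall>v \<in> verts G. f v \<in> L v) \<and>
     (\<forall>u \<in> verts G. \<forall>v \<in> verts G. u \<rightarrow>\<^bsub>G\<^esub> v \<longrightarrow> f u \<noteq> f v)"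

definition request ::
    "('a, 'b) pre_digraph \<Rightarrow> ('a \<Rightarrow> 'c set) \<Rightarrow> ('a \<rightharpoonup> 'c) \<Rightarrow> bool" where
  "request G L r \<longleftrightarrow>
     dom r \<noteq> {} \<and> dom r \<subseteq> verts G \<and> (\<forall>v \<in> dom r. the (r v) \<in> L v)"

text \<open>The next two notions are only meant for \<open>0 < \<epsilon> \<le> 1\<close>.\<close>

definition satisfiable ::
    "real \<Rightarrow> ('a, 'b) pre_digraph \<Rightarrow> ('a \<Rightarrow> 'c set) \<Rightarrow> ('a \<rightharpoonup> 'c) \<Rightarrow> bool" where
  "satisfiable \<epsilon> G L r \<longleftrightarrow>
     (\<exists>f. proper_list_coloring G L f \<and>
          \<epsilon> * real (card (dom r)) \<le> real (card {v \<in> dom r. f v = the (r v)}))"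

text \<open>
  A HOL definition cannot quantify over types, so the type of colors is passed as an explicit
  type argument; a theorem about \<open>flexible TYPE('c)\<close> with \<open>'c\<close> free covers colors of every type.
\<close>

definition flexible :: "'c itself \<Rightarrow> ('a, 'b) pre_digraph \<Rightarrow> nat \<Rightarrow> real \<Rightarrow> bool" where
  "flexible (_ :: 'c itself) G k \<epsilon> \<longleftrightarrow>
     (\<forall>(L :: 'a \<Rightarrow> 'c set) r. k_assignment G k L \<and> request G L r \<longrightarrow> satisfiable \<epsilon> G L r)"

end

theory Submission
  imports Defs
begin

text \<open>
  Color the vertices one by one along the degeneracy ordering. At each step at least two colors of
  the list are not used on earlier neighbors; flip a fair coin between two of these, one of them
  the requested color if it is free. Given the past, each color is used with probability at most
  \<open>1/2\<close>, so all of the at most \<open>d\<close> earlier neighbors of \<open>v\<close> avoid the color requested at \<open>v\<close>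
  with probability at least \<open>1 / 2 ^ d\<close>, and then the request is satisfied with probability
  \<open>1/2\<close>. The argument is derandomized by the method of conditional expectations.
\<close>

text \<open>
  A lower bound for the conditional probability that \<open>v\<close> receives its requested color \<open>p v\<close>, once
  the vertices in \<open>S\<close> have been colored by \<open>f\<close>; \<open>N v\<close> is the set of earlier neighbors of \<open>v\<close>.
\<close>

definition weight ::
    "('a \<Rightarrow> 'a set) \<Rightarrow> ('a \<Rightarrow> 'c) \<Rightarrow> 'a set \<Rightarrow> ('a \<Rightarrow> 'c) \<Rightarrow> 'a \<Rightarrow> real" where
  "weight N p S f v =
     (if v \<in> S then of_bool (f v = p v)
      else if p v \<in> f ` (N v \<inter> S) then 0
      else 1 / 2 ^ Suc (card (N v - S)))"

lemma weight_nonneg: "0 \<le> weight N p S f v"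
  by (simp add: weight_def)

text \<open>Coloring \<open>u\<close> removes one vertex from \<open>N x - S\<close>, so the
  exponent drops by one. As \<open>a\<close> differs from \<open>p x\<close>, no new conflict with
  \<open>p x\<close> arises, and a blocked vertex keeps weight 0.\<close>

lemma weight_insert_neq:
  assumes "finite (N x)" "u \<in> N x" "u \<notin> S" "x \<notin> S" "x \<noteq> u" "a \<noteq> p x"
  shows "weight N p (insert u S) (f(u := a)) x = 2 * weight N p S f x"
proof -
  have "f(u := a) ` (N x \<inter> insert u S) = insert a (f ` (N x \<inter> S))"
    using assms by auto
  moreover have "card (N x - S) = Suc (card (N x - insert u S))"
    using assms card.remove[of "N x - S" u] by (simp add: Diff_insert[symmetric])
  ultimately show ?thesis
    using assms unfolding weight_def by simp
qed

text \<open>The conditional expectation step for a fair coin between \<open>a\<close> and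
  \<open>b\<close>. Only two cases may change the weight. At \<open>x = u\<close>, an unblocked
  weight 1/2 becomes 1 for one color and 0 for the other. If \<open>u\<close> lies in
  \<open>N x\<close>, at most one of the colors equals \<open>p x\<close>, and another color doubles
  the weight, which already suffices.\<close>

lemma weight_insert_average:
  assumes "finite (N x)" "u \<notin> S" "N u \<subseteq> S" "a \<noteq> b"
    and target: "x = u \<Longrightarrow> p u \<in> f ` N u \<or> p u = a \<or> p u = b"
  shows "2 * weight N p S f x
    \<le> weight N p (insert u S) (f(u := a)) x + weight N p (insert u S) (f(u := b)) x"
proof -
  consider "x \<in> S" | "x = u" | "x \<notin> S" "x \<noteq> u" "u \<notin> N x" | "x \<notin> S" "x \<noteq> u" "u \<in> N x"
    by blast
  then show ?thesis
  proof cases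
    case 1
    then show ?thesis
      using assms by (auto simp: weight_def)
  next
    case 2
    have "N u \<inter> S = N u" "N u - S = {}"
      using assms by auto
    then show ?thesis
      using 2 assms target[OF 2] by (auto simp: weight_def)
  next
    case 3
    have "weight N p (insert u S) (f(u := c)) x = weight N p S f x" for c
    proof -
      have "f(u := c) ` (N x \<inter> insert u S) = f ` (N x \<inter> S)" "N x - insert u S = N x - S"
        using 3 assms by auto
      then show ?thesis
        using 3 by (simp add: weight_def)
    qed
    then show ?thesis
      by simp
  next
    case 4
    then have "a \<noteq> p x \<or> b \<noteq> p x"
      using assms by auto
    then show ?thesis
      using weight_insert_neq[of N x u S a p f] weight_insert_neq[of N x u S b p f] 4 assms
        weight_nonneg[of N p "insert u S" "f(u := a)" x]
        weight_nonneg[of N p "insert u S" "f(u := b)" x]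
      by auto
  qed
qed

lemma obtain_two_elements:
  assumes "2 \<le> card A"
  obtains a b where "a \<in> A" "b \<in> A" "a \<noteq> b" "c \<in> A \<longrightarrow> c = a \<or> c = b"
proof -
  define a where "a = (if c \<in> A then c else (SOME x. x \<in> A))"
  have "A \<noteq> {}"
    using assms by auto
  then have a: "a \<in> A"
    by (auto simp: a_def some_in_eq)
  have "\<not> A \<subseteq> {a}"
    using assms card_mono[of "{a}" A] by auto
  then obtain b where "b \<in> A" "b \<noteq> a"
    by auto
  then show thesis
    using that[of a b] a by (auto simp: a_def)
qed

text \<open>At most \<open>d\<close> of the \<open>d + 2\<close> colors occur on \<open>N u\<close>,
  so two are free, and \<open>p u\<close> can be among them unless it is blocked. The average over
  the two is no less than the old total weight, hence one of them does not lower it.\<close>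

lemma greedy_extension:
  assumes N: "finite (N u)" "card (N u) \<le> d" "u \<notin> S" "N u \<subseteq> S"
    and L: "finite (L u)" "card (L u) = d + 2" "u \<in> D \<Longrightarrow> p u \<in> L u"
    and D: "\<And>x. x \<in> D \<Longrightarrow> finite (N x)"
  obtains a where "a \<in> L u" "a \<notin> f ` N u"
    "(\<Sum>x\<in>D. weight N p S f x) \<le> (\<Sum>x\<in>D. weight N p (insert u S) (f(u := a)) x)"
proof -
  have "card (f ` N u) \<le> d"
    using N card_image_le le_trans by blast
  moreover have "card (L u) - card (f ` N u) \<le> card (L u - f ` N u)"
    using N by (intro diff_card_le_card_Diff) auto
  ultimately have "2 \<le> card (L u - f ` N u)"
    using L by linarith
  then obtain a b where ab: "a \<in> L u - f ` N u" "b \<in> L u - f ` N u" "a \<noteq> b"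
    "p u \<in> L u - f ` N u \<longrightarrow> p u = a \<or> p u = b"
    by (rule obtain_two_elements)
  let ?w = "\<lambda>c. \<Sum>x\<in>D. weight N p (insert u S) (f(u := c)) x"
  have "2 * (\<Sum>x\<in>D. weight N p S f x) \<le> ?w a + ?w b"
    unfolding sum_distrib_left sum.distrib[symmetric]
    using N L D ab by (intro sum_mono weight_insert_average) auto
  then have "(\<Sum>x\<in>D. weight N p S f x) \<le> ?w a \<or> (\<Sum>x\<in>D. weight N p S f x) \<le> ?w b"
    by linarith
  then show thesis
    using that ab by blast
qed

theorem theorem4:
  fixes G :: "('a, 'b) pre_digraph" and d :: nat
  assumes "graph G" and "verts G \<noteq> {}" and "degenerate G d"
  shows "flexible TYPE('c) G (d + 2) (1 / 2 ^ (d + 1))"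
  unfolding flexible_def
proof (intro allI impI, elim conjE)
  fix L :: "'a \<Rightarrow> 'c set" and r :: "'a \<rightharpoonup> 'c"
  assume L: "k_assignment G (d + 2) L" and r: "request G L r"
  interpret graph G by fact
  obtain vs where vs: "distinct vs" "set vs = verts G"
    and deg: "\<And>i. i < length vs \<Longrightarrow> card {u \<in> set (take i vs). u \<rightarrow>\<^bsub>G\<^esub> vs ! i} \<le> d"
    using assms(3) unfolding degenerate_def by blast
  \<comment> \<open>Positions in \<open>vs\<close> make this a function of the vertex alone; as
    \<open>vs\<close> is distinct, the position of \<open>v\<close> is unique and \<open>N v\<close>
    is its set of earlier neighbors.\<close>
  define N where "N v = {vs ! i |i j. i < j \<and> j < length vs \<and> vs ! j = v \<and> vs ! i \<rightarrow>\<^bsub>G\<^esub> v}" for v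
  have N_nth: "N (vs ! j) = {u \<in> set (take j vs). u \<rightarrow>\<^bsub>G\<^esub> vs ! j}" if "j < length vs" for j
    using that vs(1) by (fastforce simp: N_def in_set_conv_nth nth_eq_iff_index_eq)
  have N: "finite (N v)" "card (N v) \<le> d" if v: "v \<in> verts G" for v
  proof -
    obtain j where "j < length vs" "v = vs ! j"
      using v vs(2) by (metis in_set_conv_nth)
    then show "finite (N v)" "card (N v) \<le> d"
      using N_nth deg by simp_all
  qed
  define p where "p v = the (r v)" for v
  let ?D = "dom r"
  have D: "?D \<subseteq> verts G" "finite ?D"
    using r finite_subset[of ?D "verts G"] by (auto simp: request_def)
  \<comment> \<open>Invariant: the first \<open>i\<close> vertices are properly colored and the
    total weight has not fallen below the desired bound.\<close>
  have "\<exists>f. (\<forall>v \<in> set (take i vs). f v \<in> L v) \<and>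
      (\<forall>u \<in> set (take i vs). \<forall>v \<in> set (take i vs). u \<rightarrow>\<^bsub>G\<^esub> v \<longrightarrow> f u \<noteq> f v) \<and>
      1 / 2 ^ (d + 1) * real (card ?D) \<le> (\<Sum>v\<in>?D. weight N p (set (take i vs)) f v)"
    if "i \<le> length vs" for i
    using that
  proof (induction i)
    case 0
    \<comment> \<open>With no vertex colored nothing is blocked, and the exponent is
      \<open>card (N v) + 1\<close>, at most \<open>d + 1\<close>.\<close>
    have "1 / 2 ^ (d + 1) \<le> weight N p {} f v" if "v \<in> ?D" for v and f :: "'a \<Rightarrow> 'c"
      using N(2)[of v] that D by (auto simp: weight_def field_simps)
    from sum_mono[OF this, of ?D "\<lambda>x. x"] show ?case
      by (auto simp: mult.commute)
  next
    case (Suc i)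
    let ?S = "set (take i vs)" and ?u = "vs ! i"
    have i: "i < length vs" and S: "set (take (Suc i) vs) = insert ?u ?S"
      using Suc.prems by (auto simp: take_Suc_conv_app_nth)
    have u: "?u \<in> verts G" "?u \<notin> ?S"
      using i vs nth_mem[OF i] distinct_take[OF vs(1), of "Suc i"]
      by (simp_all add: take_Suc_conv_app_nth)
    obtain f where f: "\<forall>v \<in> ?S. f v \<in> L v"
      "\<forall>u \<in> ?S. \<forall>v \<in> ?S. u \<rightarrow>\<^bsub>G\<^esub> v \<longrightarrow> f u \<noteq> f v"
      "1 / 2 ^ (d + 1) * real (card ?D) \<le> (\<Sum>v\<in>?D. weight N p ?S f v)"
      using Suc by auto
    have "N ?u \<subseteq> ?S"
      using N_nth[OF i] by auto
    moreover have "finite (L ?u)" "card (L ?u) = d + 2" "?u \<in> ?D \<Longrightarrow> p ?u \<in> L ?u"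
      using L r u(1) by (simp_all add: k_assignment_def request_def p_def)
    moreover have "finite (N x)" if "x \<in> ?D" for x
      using N(1) D(1) that by auto
    ultimately obtain a where a: "a \<in> L ?u" "a \<notin> f ` N ?u"
      "(\<Sum>x\<in>?D. weight N p ?S f x) \<le> (\<Sum>x\<in>?D. weight N p (insert ?u ?S) (f(?u := a)) x)"
      using greedy_extension[of N ?u d ?S L ?D p f] N[OF u(1)] u(2) by metis
    \<comment> \<open>By symmetry of the arcs, either direction places \<open>v\<close> in
      \<open>N ?u\<close>, whose colors \<open>a\<close> avoids.\<close>
    have new: "f v \<noteq> a" if "v \<in> ?S" "v \<rightarrow>\<^bsub>G\<^esub> ?u \<or> ?u \<rightarrow>\<^bsub>G\<^esub> v" for v
      using a(2) that N_nth[OF i] arcs_ends_symmetric[OF sym_arcs] by auto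
    have "\<not> ?u \<rightarrow>\<^bsub>G\<^esub> ?u"
      using adj_not_same by blast
    then have "\<forall>x \<in> insert ?u ?S. \<forall>y \<in> insert ?u ?S. x \<rightarrow>\<^bsub>G\<^esub> y \<longrightarrow> (f(?u := a)) x \<noteq> (f(?u := a)) y"
      using f(2) new u(2) by (metis fun_upd_apply insert_iff)
    moreover have "\<forall>v \<in> insert ?u ?S. (f(?u := a)) v \<in> L v"
      using f(1) a(1) by auto
    ultimately show ?case
      unfolding S using f(3) a(3) by (meson order_trans)
  qed
  from this[of "length vs"] obtain f where f: "\<forall>v \<in> verts G. f v \<in> L v"
    "\<forall>u \<in> verts G. \<forall>v \<in> verts G. u \<rightarrow>\<^bsub>G\<^esub> v \<longrightarrow> f u \<noteq> f v"
    "1 / 2 ^ (d + 1) * real (card ?D) \<le> (\<Sum>v\<in>?D. weight N p (verts G) f v)"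
    using vs(2) by auto
  \<comment> \<open>Once every vertex is colored, each weight is the indicator of a satisfied
    request.\<close>
  have "(\<Sum>v\<in>?D. weight N p (verts G) f v) = (\<Sum>v\<in>?D. of_bool (f v = p v))"
    using D by (intro sum.cong) (auto simp: weight_def)
  also have "\<dots> = real (card {v \<in> ?D. f v = the (r v)})"
    using D(2) by (simp add: p_def Int_def)
  finally show "satisfiable (1 / 2 ^ (d + 1)) G L r"
    using f unfolding satisfiable_def proper_list_coloring_def by auto
qed

end
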